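(* Let $r\in\mathbb{N}$, $n_1,\dots,n_r\in\mathbb{N}$ and $n:=\min\{n_1,\dots,n_r\}$. The function $$K_{n_r,\dots,n_1}(x,y)=\sum_{k=0}^n c_k\,(k+1)\sum_{\ell=0}^k p_{k,\ell}(x)\,p_{k,\ell}(y),\qquad x,y\in[0,1],$$ where $(c_0,\dots,c_n)$ is the unique solution of the linear system $$\sum_{k=0}^n\frac{k^{\underline{j}}}{(k+j+1)^{\underline{j}}}\,c_k=\prod_{i=1}^r\frac{n_i^{\underline{j}}}{(n_i+j+1)^{\underline{j}}},\qquad j=0,1,\dots,n,$$ is the kernel of the operator $M_{n_r}\circ\cdots\circ M_{n_1}$, i.e., $$((M_{n_r}\circ\cdots\circ M_{n_1})f)(x)=\int_0^1 f(y)\,K_{n_r,\dots,n_1}(x,y)\,dy,\qquad f\in L_1[0,1],\ x\in[0,1].$$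
   Context: $\mathbb{N}$ denotes the positive integers. Falling factorials: $z^{\underline{0}}=1$ and $z^{\underline{j}}=z(z-1)\cdots(z-j+1)$ for $j\in\mathbb{N}$. For integers $n\ge 0$ and $0\le k\le n$, let $p_{n,k}(x)=\binom{n}{k}x^k(1-x)^{n-k}$. The Bernstein--Durrmeyer operator $M_n$ maps $f\in L_1[0,1]$ to the polynomial $$(M_nf)(x)=(n+1)\sum_{k=0}^n p_{n,k}(x)\int_0^1 f(y)\,p_{n,k}(y)\,dy,\quad x\in[0,1].$$ *)

theory Defs
  imports "HOL-Analysis.Analysis"
begin

definition falling_fact :: "real \<Rightarrow> nat \<Rightarrow> real" where
  "falling_fact z j = (\<Prod>i<j. z - real i)"

(* Only the values of f on [0,1] matter. The result is given by the same polynomial formula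
   on the whole real line. *)
definition bernstein_durrmeyer :: "nat \<Rightarrow> (real \<Rightarrow> real) \<Rightarrow> real \<Rightarrow> real" where
  "bernstein_durrmeyer n f x =
     (real n + 1) * (\<Sum>k=0..n. Bernstein n k x * (LINT y:{0..1}|lebesgue. f y * Bernstein n k y))"

(* The composition M_{m r} o ... o M_{m 1}; the operator with index m 1 is applied first. *)
primrec bernstein_durrmeyer_comp :: "(nat \<Rightarrow> nat) \<Rightarrow> nat \<Rightarrow> (real \<Rightarrow> real) \<Rightarrow> real \<Rightarrow> real" where
  "bernstein_durrmeyer_comp m 0 = id"
| "bernstein_durrmeyer_comp m (Suc r) =
     bernstein_durrmeyer (m (Suc r)) \<circ> bernstein_durrmeyer_comp m r"

definition kernel_system :: "(nat \<Rightarrow> nat) \<Rightarrow> nat \<Rightarrow> nat \<Rightarrow> (nat \<Rightarrow> real) \<Rightarrow> bool" where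
  "kernel_system m r n c \<longleftrightarrow>
     (\<forall>j\<in>{0..n}.
        (\<Sum>k=0..n. falling_fact (real k) j / falling_fact (real (k + j + 1)) j * c k)
        = (\<Prod>i=1..r. falling_fact (real (m i)) j / falling_fact (real (m i + j + 1)) j))"

definition durrmeyer_kernel :: "nat \<Rightarrow> (nat \<Rightarrow> real) \<Rightarrow> real \<Rightarrow> real \<Rightarrow> real" where
  "durrmeyer_kernel n c x y =
     (\<Sum>k=0..n. c k * (real k + 1) * (\<Sum>l=0..k. Bernstein k l x * Bernstein k l y))"

end

theory Submission
  imports Defs "HOL-Computational_Algebra.Polynomial"
begin

text \<open>
  All Bernstein--Durrmeyer operators are diagonal in one and the same orthogonal basis, so both
  kernels in question can be compared coefficient by coefficient in that basis.

  The operator \<open>M\<^sub>n\<close> is self-adjoint for the inner product of \<open>L\<^sub>2[0,1]\<close>, because its kernel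
  \<open>(n + 1) \<Sum>\<^sub>k p\<^sub>n\<^sub>,\<^sub>k(x) p\<^sub>n\<^sub>,\<^sub>k(y)\<close> is symmetric. Evaluating Beta integrals shows that \<open>M\<^sub>n\<close> maps \<open>x^j\<close> to
  a polynomial of degree at most \<open>j\<close> whose coefficient at \<open>x^j\<close> is the ratio of falling factorials
  \<open>\<lambda>\<^sub>n\<^sub>,\<^sub>j\<close> that appears in the linear system (\<open>durrmeyer_poly_triangular\<close>). A self-adjoint
  operator that preserves every space of polynomials of bounded degree is diagonal in the
  orthogonal polynomials \<open>E\<^sub>j\<close>, here the Legendre polynomials shifted to the unit interval; hence
  \<open>M\<^sub>n E\<^sub>j = \<lambda>\<^sub>n\<^sub>,\<^sub>j E\<^sub>j\<close> (\<open>durrmeyer_poly_monic_legendre\<close>).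

  Consequently the kernel of \<open>M\<^sub>k\<close> is \<open>\<Sum>\<^sub>j \<lambda>\<^sub>k\<^sub>,\<^sub>j E\<^sub>j(x) E\<^sub>j(y) / \<parallel>E\<^sub>j\<parallel>\<^sup>2\<close> (\<open>kernel_slice_spectral\<close>), and composing
  operators multiplies the eigenvalues (\<open>bernstein_durrmeyer_comp_spectral\<close>). The linear
  combination with weights \<open>c\<^sub>k\<close> of the kernels of \<open>M\<^sub>0, \<dots>, M\<^sub>n\<close> therefore represents the composition as soon as
  \<open>\<Sum>\<^sub>k \<lambda>\<^sub>k\<^sub>,\<^sub>j c\<^sub>k = \<Prod>\<^sub>i \<lambda>\<^sub>n\<^sub>i\<^sub>,\<^sub>j\<close> for every \<open>j\<close>. For \<open>j \<le> n\<close> this is the linear system, and for \<open>j > n\<close> both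
  sides vanish, since \<open>\<lambda>\<^sub>k\<^sub>,\<^sub>j = 0\<close> whenever \<open>k < j\<close>. The same vanishing makes the system triangular with
  nonzero diagonal, hence uniquely solvable (\<open>triangular_system_unique_solution\<close>).
\<close>

section \<open>The pairing of integrable functions with polynomials\<close>

text \<open>
  The left argument is a function, so that the same notion covers an arbitrary integrable
  input and, with \<open>poly p\<close> on the left, the \<open>L\<^sub>2\<close> inner product of two polynomials.
\<close>
definition pairing :: "(real \<Rightarrow> real) \<Rightarrow> real poly \<Rightarrow> real" where
  "pairing f q = (LINT y:{0..1}|lebesgue. f y * poly q y)"

lemma smult_sum_right: "smult a (\<Sum>i\<in>A. q i) = (\<Sum>i\<in>A. smult a (q i))"
  by (induction A rule: infinite_finite_induct) (simp_all add: smult_add_right)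

lemma set_integrable_poly: "set_integrable lebesgue {0..1} (poly p)" for p :: "real poly"
  by (intro absolutely_integrable_continuous_real continuous_intros)

lemma set_integrable_mult_poly:
  fixes q :: "real poly"
  assumes "set_integrable lebesgue {0..1} f"
  shows "set_integrable lebesgue {0..1} (\<lambda>y. f y * poly q y)"
proof -
  have "(\<lambda>y. poly q y * f y) absolutely_integrable_on {0..1}"
  proof (rule absolutely_integrable_bounded_measurable_product_real)
    have cont: "continuous_on {0..1} (poly q)"
      by (intro continuous_intros)
    show "poly q \<in> borel_measurable (lebesgue_on {0..1})"
      using cont by (rule continuous_imp_measurable_on_sets_lebesgue) auto
    show "bounded (poly q ` {0..1})"
      using cont by (intro compact_imp_bounded compact_continuous_image) auto
  qed (use assms in auto)
  then show ?thesis
    by (simp add: mult.commute)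
qed

lemma pairing_0 [simp]: "pairing f 0 = 0"
  by (simp add: pairing_def)

lemma pairing_add:
  assumes "set_integrable lebesgue {0..1} f"
  shows "pairing f (p + q) = pairing f p + pairing f q"
  unfolding pairing_def
  by (simp add: distrib_left set_integral_add set_integrable_mult_poly assms)

lemma pairing_smult [simp]: "pairing f (smult a q) = a * pairing f q"
  unfolding pairing_def by (simp add: mult.left_commute)

lemma pairing_diff:
  assumes "set_integrable lebesgue {0..1} f"
  shows "pairing f (p - q) = pairing f p - pairing f q"
  unfolding pairing_def
  by (simp add: right_diff_distrib set_integral_diff set_integrable_mult_poly assms)

lemma pairing_sum:
  assumes "set_integrable lebesgue {0..1} f"
  shows "pairing f (\<Sum>i\<in>A. q i) = (\<Sum>i\<in>A. pairing f (q i))"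
  by (induction A rule: infinite_finite_induct) (simp_all add: pairing_add assms)

lemma pairing_commute: "pairing (poly p) q = pairing (poly q) p"
  unfolding pairing_def by (simp add: mult.commute)

lemmas pairing_poly_linear =
  pairing_add[OF set_integrable_poly] pairing_diff[OF set_integrable_poly]
  pairing_sum[OF set_integrable_poly]

lemma pairing_self_eq_0:
  assumes "pairing (poly p) p = 0"
  shows "p = 0"
proof (rule ccontr)
  assume "p \<noteq> 0"
  have "integral {0..1} (\<lambda>y. poly p y * poly p y) = 0"
    using assms set_lebesgue_integral_eq_integral(2)[OF set_integrable_mult_poly[OF set_integrable_poly]]
    by (simp add: pairing_def)
  then have "\<forall>y\<in>{0..1}. poly p y * poly p y = 0"
    by (subst (asm) integral_eq_0_iff) (auto intro!: continuous_intros)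
  then have "{0..1} \<subseteq> {y. poly p y = 0}"
    by auto
  moreover have "infinite {0..1::real}"
    by (rule infinite_Icc) simp
  ultimately show False
    using poly_roots_finite[OF \<open>p \<noteq> 0\<close>] finite_subset by blast
qed

section \<open>Orthogonal polynomials on the unit interval\<close>

text \<open>
  The Gram--Schmidt process applied to the monomials. Keeping the polynomials monic rather than
  normalizing them makes the coefficient comparison for the eigenvalues immediate.
\<close>
fun monic_legendre :: "nat \<Rightarrow> real poly" where
  "monic_legendre n = monom 1 n - (\<Sum>i<n.
     smult (pairing (poly (monom 1 n)) (monic_legendre i)
            / pairing (poly (monic_legendre i)) (monic_legendre i)) (monic_legendre i))"

(* The recursion equation has no base case, so as a rewrite rule it would unfold forever. *)
declare monic_legendre.simps [simp del]

definition legendre_norm_sq :: "nat \<Rightarrow> real" where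
  "legendre_norm_sq j = pairing (poly (monic_legendre j)) (monic_legendre j)"

lemma coeff_monic_legendre_above: "k > n \<Longrightarrow> coeff (monic_legendre n) k = 0"
proof (induction n rule: less_induct)
  case (less n)
  then show ?case
    by (subst monic_legendre.simps) (auto simp: coeff_sum intro!: sum.neutral)
qed

lemma coeff_monic_legendre_self: "coeff (monic_legendre n) n = 1"
  by (subst monic_legendre.simps) (auto simp: coeff_sum coeff_monic_legendre_above)

lemma legendre_norm_sq_neq_0: "legendre_norm_sq j \<noteq> 0"
proof
  assume "legendre_norm_sq j = 0"
  then have "monic_legendre j = 0"
    unfolding legendre_norm_sq_def by (rule pairing_self_eq_0)
  then show False
    using coeff_monic_legendre_self[of j] by simp
qed

lemma monic_legendre_orthogonal_less:
  "i < j \<Longrightarrow> pairing (poly (monic_legendre i)) (monic_legendre j) = 0"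
proof (induction j arbitrary: i rule: less_induct)
  case (less j)
  let ?E = monic_legendre
  have orth: "pairing (poly (?E i)) (?E k) = (if k = i then legendre_norm_sq i else 0)" if "k < j" for k
    using less.IH[of i k] less.IH[of k i] less.prems that
    by (cases i k rule: linorder_cases) (auto simp: pairing_commute legendre_norm_sq_def)
  have "pairing (poly (?E i)) (?E j) = pairing (poly (?E i)) (monom 1 j)
      - (\<Sum>k<j. pairing (poly (monom 1 j)) (?E k) / legendre_norm_sq k
                 * pairing (poly (?E i)) (?E k))"
    by (subst (2) monic_legendre.simps) (simp add: pairing_poly_linear legendre_norm_sq_def)
  also have "(\<Sum>k<j. pairing (poly (monom 1 j)) (?E k) / legendre_norm_sq k
                 * pairing (poly (?E i)) (?E k))
     = (\<Sum>k<j. if k = i then pairing (poly (monom 1 j)) (?E i) else 0)"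
    by (intro sum.cong refl) (simp add: orth legendre_norm_sq_neq_0)
  also have "\<dots> = pairing (poly (monom 1 j)) (?E i)"
    using less.prems by simp
  finally show ?case
    by (simp add: pairing_commute)
qed

lemma monic_legendre_orthogonal:
  "pairing (poly (monic_legendre i)) (monic_legendre j) = (if i = j then legendre_norm_sq j else 0)"
  using monic_legendre_orthogonal_less[of i j] monic_legendre_orthogonal_less[of j i]
  by (cases i j rule: linorder_cases) (auto simp: pairing_commute legendre_norm_sq_def)

text \<open>
  Since the polynomials are monic with one in each degree, subtracting a suitable multiple of
  the last one lowers the degree. The degree bound is expressed through vanishing coefficients
  so that it makes sense for \<open>n = 0\<close>, where it says \<open>q = 0\<close>.
\<close>
lemma span_monic_legendre:
  assumes "\<And>i. i \<ge> n \<Longrightarrow> coeff q i = 0"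
  shows "\<exists>a. q = (\<Sum>i<n. smult (a i) (monic_legendre i))"
  using assms
proof (induction n arbitrary: q)
  case 0
  then show ?case
    by (auto simp: poly_eq_iff)
next
  case (Suc n)
  define q' where "q' = q - smult (coeff q n) (monic_legendre n)"
  have "coeff q' i = 0" if "i \<ge> n" for i
    using that Suc.prems[of i] unfolding q'_def
    by (cases "i = n") (auto simp: coeff_monic_legendre_self coeff_monic_legendre_above)
  then obtain a where a: "q' = (\<Sum>i<n. smult (a i) (monic_legendre i))"
    using Suc.IH by blast
  have "(\<Sum>i<n. smult ((a(n := coeff q n)) i) (monic_legendre i)) = q'"
    unfolding a by (intro sum.cong) auto
  then have "q = (\<Sum>i<Suc n. smult ((a(n := coeff q n)) i) (monic_legendre i))"
    by (simp add: q'_def)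
  then show ?case
    by blast
qed

lemma legendre_expansion:
  assumes "\<And>i. i \<ge> n \<Longrightarrow> coeff q i = 0"
  shows "q = (\<Sum>j<n. smult (pairing (poly q) (monic_legendre j) / legendre_norm_sq j) (monic_legendre j))"
proof -
  obtain a where a: "q = (\<Sum>i<n. smult (a i) (monic_legendre i))"
    using span_monic_legendre[OF assms] by blast
  have "pairing (poly q) (monic_legendre j) = a j * legendre_norm_sq j" if "j < n" for j
  proof -
    have "pairing (poly q) (monic_legendre j) = pairing (poly (monic_legendre j)) q"
      by (rule pairing_commute)
    also have "\<dots> = (\<Sum>i<n. if i = j then a j * legendre_norm_sq j else 0)"
      unfolding a pairing_poly_linear pairing_smult
      by (intro sum.cong refl) (simp add: monic_legendre_orthogonal)
    finally show ?thesis
      using that by simp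
  qed
  then show ?thesis
    by (subst a) (auto simp: legendre_norm_sq_neq_0 intro!: sum.cong)
qed

lemma monic_legendre_orthogonal_lower_degree:
  assumes "\<And>i. i \<ge> j \<Longrightarrow> coeff q i = 0"
  shows "pairing (poly (monic_legendre j)) q = 0"
  by (subst legendre_expansion[of j q, OF assms])
     (auto simp: pairing_poly_linear monic_legendre_orthogonal intro!: sum.neutral)

section \<open>The eigenvalues\<close>

text \<open>The coefficients of the linear system will turn out to be the eigenvalues of \<open>M\<^sub>n\<close>.\<close>
definition eigenvalue :: "nat \<Rightarrow> nat \<Rightarrow> real" where
  "eigenvalue n j = falling_fact (real n) j / falling_fact (real (n + j + 1)) j"

lemma falling_fact_binomial: "falling_fact (real n) j = fact j * real (n choose j)"
  by (simp add: falling_fact_def binomial_gbinomial gbinomial_prod_rev atLeast0LessThan)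

lemma eigenvalue_binomial: "eigenvalue n j = real (n choose j) / real ((n + j + 1) choose j)"
  by (simp add: eigenvalue_def falling_fact_binomial del: of_nat_Suc of_nat_add)

lemma eigenvalue_eq_0: "n < j \<Longrightarrow> eigenvalue n j = 0"
  by (simp add: eigenvalue_binomial)

lemma eigenvalue_diagonal_neq_0: "eigenvalue n n \<noteq> 0"
  by (simp add: eigenvalue_binomial)

section \<open>Bernstein--Durrmeyer operators on polynomials\<close>

definition bernstein_poly :: "nat \<Rightarrow> nat \<Rightarrow> real poly" where
  "bernstein_poly n k = smult (of_nat (n choose k)) (monom 1 k * [:1, -1:] ^ (n - k))"

lemma poly_bernstein_poly [simp]: "poly (bernstein_poly n k) x = Bernstein n k x"
  by (simp add: bernstein_poly_def Bernstein_def poly_monom)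

lemma coeff_bernstein_poly_above:
  assumes "k \<le> n" "i > n"
  shows "coeff (bernstein_poly n k) i = 0"
proof (rule coeff_eq_0)
  have "degree (monom 1 k * [:1, -1::real:] ^ (n - k)) \<le> k + (n - k)"
    by (intro order.trans[OF degree_mult_le] add_mono degree_monom_le
        order.trans[OF degree_power_le]) simp
  then have "degree (bernstein_poly n k) \<le> n"
    unfolding bernstein_poly_def using assms(1)
    by (intro order.trans[OF degree_smult_le]) simp
  then show "degree (bernstein_poly n k) < i"
    using assms(2) by simp
qed

text \<open>
  The operator \<open>M\<^sub>n\<close> on polynomials, with a value in the type of polynomials so that degrees
  and coefficients of the result can be examined.
\<close>
definition durrmeyer_poly :: "nat \<Rightarrow> real poly \<Rightarrow> real poly" where
  "durrmeyer_poly n p =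
     smult (real n + 1) (\<Sum>k=0..n. smult (pairing (poly p) (bernstein_poly n k)) (bernstein_poly n k))"

lemma durrmeyer_poly_selfadjoint:
  "pairing (poly (durrmeyer_poly n p)) q = pairing (poly p) (durrmeyer_poly n q)"
proof -
  have "pairing (poly (durrmeyer_poly n p)) q = pairing (poly q) (durrmeyer_poly n p)"
    by (rule pairing_commute)
  then show ?thesis
    by (simp add: durrmeyer_poly_def pairing_poly_linear pairing_commute mult.commute)
qed

lemma durrmeyer_poly_smult: "durrmeyer_poly n (smult a p) = smult a (durrmeyer_poly n p)"
proof -
  have "pairing (poly (smult a p)) q = a * pairing (poly p) q" for q
    by (subst (1 2) pairing_commute) simp
  then show ?thesis
    by (simp add: durrmeyer_poly_def smult_sum_right mult.commute mult.left_commute)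
qed

lemma durrmeyer_poly_add: "durrmeyer_poly n (p + q) = durrmeyer_poly n p + durrmeyer_poly n q"
proof -
  have "pairing (poly (p + q)) s = pairing (poly p) s + pairing (poly q) s" for s
    by (subst (1 2 3) pairing_commute) (simp add: pairing_poly_linear)
  then show ?thesis
    by (simp add: durrmeyer_poly_def smult_add_left sum.distrib smult_add_right)
qed

lemma durrmeyer_poly_0 [simp]: "durrmeyer_poly n 0 = 0"
  using durrmeyer_poly_smult[of n 0 0] by simp

lemma durrmeyer_poly_sum: "durrmeyer_poly n (\<Sum>i\<in>A. q i) = (\<Sum>i\<in>A. durrmeyer_poly n (q i))"
  by (induction A rule: infinite_finite_induct) (simp_all add: durrmeyer_poly_add)

text \<open>
  The Beta integral at positive integers. The spike at the endpoints is needed because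
  \<open>0 powr 0 = 0\<close> whereas \<open>0 ^ 0 = 1\<close>.
\<close>
lemma integral_power_mult_power:
  "(LINT y:{0..1}|lebesgue. y ^ a * (1 - y) ^ b) = fact a * fact b / (fact (a + b + 1) :: real)"
proof -
  have "((\<lambda>t. t powr (real (a + 1) - 1) * (1 - t) powr (real (b + 1) - 1))
      has_integral Beta (real (a + 1)) (real (b + 1))) {0..1}"
    by (rule has_integral_Beta_real) auto
  then have "((\<lambda>t::real. t ^ a * (1 - t) ^ b) has_integral Beta (real (a + 1)) (real (b + 1))) {0..1}"
    by (rule has_integral_spike_finite[where S = "{0, 1}", rotated 2]) (auto simp: powr_realpow)
  moreover have "Beta (real (a + 1)) (real (b + 1)) = fact a * fact b / fact (a + b + 1)"
    using Gamma_fact[where 'a = real, of a] Gamma_fact[where 'a = real, of b]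
      Gamma_fact[where 'a = real, of "a + b + 1"]
    by (simp add: Beta_def algebra_simps)
  moreover have "set_integrable lebesgue {0..1} (\<lambda>t::real. t ^ a * (1 - t) ^ b)"
    by (intro absolutely_integrable_continuous_real continuous_intros)
  ultimately show ?thesis
    by (simp add: set_lebesgue_integral_eq_integral(2) integral_unique)
qed

lemma pairing_monom_bernstein_poly:
  assumes "k \<le> n"
  shows "(real n + 1) * pairing (poly (monom 1 j)) (bernstein_poly n k)
    = real (k + j choose j) / real (n + j + 1 choose j)"
proof -
  have "pairing (poly (monom 1 j)) (bernstein_poly n k)
      = (LINT y:{0..1}|lebesgue. real (n choose k) * (y ^ (k + j) * (1 - y) ^ (n - k)))"
    unfolding pairing_def by (simp add: poly_monom Bernstein_def power_add mult_ac)
  also have "\<dots> = real (n choose k) * (fact (k + j) * fact (n - k) / fact (n + j + 1))"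
    unfolding set_integral_mult_right integral_power_mult_power using assms by (simp add: add.commute[of j])
  also have "\<dots> = fact n * fact (k + j) / (fact k * fact (n + j + 1))"
    using assms by (simp add: binomial_fact)
  finally have "(real n + 1) * pairing (poly (monom 1 j)) (bernstein_poly n k)
     = fact (n + 1) * fact (k + j) / (fact k * fact (n + j + 1))"
    by (simp add: algebra_simps)
  also have "\<dots> = real (k + j choose j) / real (n + j + 1 choose j)"
    by (simp add: binomial_fact add.commute[of j])
  finally show ?thesis .
qed

text \<open>
  The factorial moments of the binomial distribution: as
  \<open>(n choose k) (k choose i) = (n choose i) (n - i choose k - i)\<close>, the sum reduces to the
  total mass of the distribution with \<open>n - i\<close> trials.
\<close>
lemma sum_binomial_Bernstein:
  "(\<Sum>k=0..n. real (k choose i) * Bernstein n k x) = real (n choose i) * x ^ i"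
proof (cases "i \<le> n")
  case True
  have "(\<Sum>k=0..n. real (k choose i) * Bernstein n k x)
      = (\<Sum>k=i..n. real (k choose i) * Bernstein n k x)"
    using True by (intro sum.mono_neutral_right) auto
  also have "\<dots> = (\<Sum>l\<le>n-i. real (l + i choose i) * Bernstein n (l + i) x)"
    using True by (intro sum.reindex_bij_witness[of _ "\<lambda>l. l + i" "\<lambda>k. k - i"]) auto
  also have "\<dots> = (\<Sum>l\<le>n-i. real (n choose i) * x ^ i * Bernstein (n - i) l x)"
  proof (intro sum.cong refl)
    fix l assume "l \<in> {..n-i}"
    then have l: "l + i \<le> n"
      using True by auto
    then have "real (n choose (l + i)) * real (l + i choose i) = real (n choose i) * real (n - i choose l)"
      using choose_mult[of i "l + i" n] by (simp flip: of_nat_mult)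
    then show "real (l + i choose i) * Bernstein n (l + i) x = real (n choose i) * x ^ i * Bernstein (n - i) l x"
      by (simp add: Bernstein_def power_add mult_ac) (simp add: add.commute mult_ac)
  qed
  also have "\<dots> = real (n choose i) * x ^ i * (\<Sum>l\<le>n-i. Bernstein (n - i) l x)"
    by (rule sum_distrib_left[symmetric])
  finally show ?thesis
    by simp
next
  case False
  then show ?thesis
    by (simp add: sum.neutral)
qed

text \<open>
  The moments of the Bernstein polynomials are proportional to \<open>(k + j choose j)\<close>. The Vandermonde
  identity rewrites these in the basis \<open>(k choose i)\<close>, whose Bernstein sums are multiples of \<open>x^i\<close>.
\<close>
lemma durrmeyer_poly_monom:
  "durrmeyer_poly n (monom 1 j) =
    (\<Sum>i\<le>j. monom (real (j choose i) * real (n choose i) / real (n + j + 1 choose j)) i)"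
proof -
  let ?C = "real (n + j + 1 choose j)"
  have vand: "real (k + j choose j) = (\<Sum>i\<le>j. real (j choose i) * real (k choose i))" for k
  proof -
    have "(k + j choose j) = (\<Sum>i\<le>j. (j choose i) * (k choose i))"
      unfolding vandermonde[symmetric]
      by (intro sum.cong refl) (metis atMost_iff binomial_symmetric mult.commute)
    then show ?thesis
      by simp
  qed
  have "poly (durrmeyer_poly n (monom 1 j)) x
      = poly (\<Sum>i\<le>j. monom (real (j choose i) * real (n choose i) / ?C) i) x" for x
  proof -
    have "poly (durrmeyer_poly n (monom 1 j)) x
        = (\<Sum>k=0..n. ((real n + 1) * pairing (poly (monom 1 j)) (bernstein_poly n k)) * Bernstein n k x)"
      by (simp add: durrmeyer_poly_def poly_sum sum_distrib_left mult_ac)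
    also have "\<dots> = (\<Sum>k=0..n. real (k + j choose j) / ?C * Bernstein n k x)"
      by (intro sum.cong refl) (simp add: pairing_monom_bernstein_poly del: of_nat_Suc)
    also have "\<dots> = (\<Sum>k=0..n. \<Sum>i\<le>j. real (j choose i) / ?C * (real (k choose i) * Bernstein n k x))"
      unfolding vand sum_divide_distrib sum_distrib_right by (simp add: mult_ac)
    also have "\<dots> = (\<Sum>i\<le>j. real (j choose i) / ?C * (\<Sum>k=0..n. real (k choose i) * Bernstein n k x))"
      by (subst sum.swap) (simp add: sum_distrib_left)
    also have "\<dots> = poly (\<Sum>i\<le>j. monom (real (j choose i) * real (n choose i) / ?C) i) x"
      unfolding sum_binomial_Bernstein by (simp add: poly_sum poly_monom mult_ac)
    finally show ?thesis .
  qed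
  then show ?thesis
    by (simp add: poly_eq_poly_eq_iff[symmetric] fun_eq_iff)
qed

lemma durrmeyer_poly_triangular:
  assumes "\<And>i. i > d \<Longrightarrow> coeff p i = 0"
  shows "i > d \<Longrightarrow> coeff (durrmeyer_poly n p) i = 0"
    and "coeff (durrmeyer_poly n p) d = eigenvalue n d * coeff p d"
proof -
  have "p = (\<Sum>j\<le>d. smult (coeff p j) (monom 1 j))"
    using assms by (intro poly_eqI) (auto simp: coeff_sum smult_monom not_le)
  then have D: "durrmeyer_poly n p = (\<Sum>j\<le>d. smult (coeff p j) (durrmeyer_poly n (monom 1 j)))"
    by (metis (no_types, lifting) durrmeyer_poly_smult durrmeyer_poly_sum sum.cong)
  have mono: "coeff (durrmeyer_poly n (monom 1 j)) i
      = (if i \<le> j then real (j choose i) * real (n choose i) / real (n + j + 1 choose j) else 0)" for i j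
    unfolding durrmeyer_poly_monom by (auto simp: coeff_sum)
  show "i > d \<Longrightarrow> coeff (durrmeyer_poly n p) i = 0"
    unfolding D by (auto simp: coeff_sum mono)
  have "coeff (durrmeyer_poly n p) d = (\<Sum>j\<le>d. if j = d then eigenvalue n d * coeff p d else 0)"
    unfolding D coeff_sum coeff_smult mono
    by (intro sum.cong refl) (auto simp: eigenvalue_binomial)
  then show "coeff (durrmeyer_poly n p) d = eigenvalue n d * coeff p d"
    by simp
qed

text \<open>
  The difference \<open>g\<close> of the two sides has degree below \<open>j\<close>, because the eigenvalue was chosen to
  cancel the coefficient at \<open>x^j\<close>. By self-adjointness \<open>g\<close> is orthogonal to itself, since \<open>g\<close> and its
  image under \<open>M\<^sub>n\<close> both have degree below \<open>j\<close> and are thus orthogonal to \<open>E\<^sub>j\<close>.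
\<close>
lemma durrmeyer_poly_monic_legendre:
  "durrmeyer_poly n (monic_legendre j) = smult (eigenvalue n j) (monic_legendre j)"
proof -
  let ?E = "monic_legendre j"
  define g where "g = durrmeyer_poly n ?E - smult (eigenvalue n j) ?E"
  have g: "coeff g i = 0" if "i \<ge> j" for i
    using that durrmeyer_poly_triangular[of j ?E, OF coeff_monic_legendre_above]
    by (cases "i = j") (auto simp: g_def coeff_monic_legendre_above coeff_monic_legendre_self)
  have Dg: "coeff (durrmeyer_poly n g) i = 0" if "i \<ge> j" for i
  proof (cases "i = j")
    case True
    have "coeff (durrmeyer_poly n g) j = eigenvalue n j * coeff g j"
      by (rule durrmeyer_poly_triangular) (use g in auto)
    then show ?thesis
      using True g by simp
  next
    case False
    show ?thesis
      by (rule durrmeyer_poly_triangular(1)[of j]) (use False that g in auto)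
  qed
  have "pairing (poly g) g = pairing (poly g) (durrmeyer_poly n ?E) - eigenvalue n j * pairing (poly g) ?E"
    by (subst (2) g_def) (simp add: pairing_poly_linear)
  also have "\<dots> = pairing (poly ?E) (durrmeyer_poly n g) - eigenvalue n j * pairing (poly ?E) g"
    by (simp add: pairing_commute[of g] durrmeyer_poly_selfadjoint)
  also have "\<dots> = 0"
    using g Dg by (simp add: monic_legendre_orthogonal_lower_degree)
  finally have "g = 0"
    by (rule pairing_self_eq_0)
  then show ?thesis
    by (simp add: g_def)
qed

section \<open>Spectral form of the kernels\<close>

text \<open>
  The kernel of \<open>M\<^sub>n\<close> at a fixed point \<open>x\<close>, as a polynomial in the integration variable. In this form
  every kernel integral becomes a pairing.
\<close>
definition kernel_slice :: "nat \<Rightarrow> real \<Rightarrow> real poly" where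
  "kernel_slice n x = smult (real n + 1) (\<Sum>k=0..n. smult (Bernstein n k x) (bernstein_poly n k))"

lemma poly_kernel_slice:
  "poly (kernel_slice n x) y = (real n + 1) * (\<Sum>l=0..n. Bernstein n l x * Bernstein n l y)"
  by (simp add: kernel_slice_def poly_sum)

lemma bernstein_durrmeyer_eq_pairing:
  assumes "set_integrable lebesgue {0..1} f"
  shows "bernstein_durrmeyer n f x = pairing f (kernel_slice n x)"
  by (simp add: kernel_slice_def pairing_sum[OF assms] bernstein_durrmeyer_def)
     (simp add: pairing_def)

text \<open>
  The inner product of the slice at \<open>x\<close> with \<open>E\<^sub>j\<close> is \<open>(M\<^sub>n E\<^sub>j)(x)\<close>, so its orthogonal expansion has the
  eigenvalues as coefficients. The upper limit may be any \<open>N \<ge> n\<close>, which lets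
  operators of different orders share one range of summation.
\<close>
lemma kernel_slice_spectral:
  assumes "n \<le> N"
  shows "kernel_slice n x = (\<Sum>j\<le>N.
    smult (eigenvalue n j * poly (monic_legendre j) x / legendre_norm_sq j) (monic_legendre j))"
proof -
  let ?E = monic_legendre
  have coeffs: "coeff (kernel_slice n x) i = 0" if "i \<ge> Suc N" for i
    using that assms by (simp add: kernel_slice_def coeff_sum coeff_bernstein_poly_above)
  have "pairing (poly (kernel_slice n x)) (?E j) = eigenvalue n j * poly (?E j) x" for j
  proof -
    have "pairing (poly (kernel_slice n x)) (?E j) = pairing (poly (?E j)) (kernel_slice n x)"
      by (rule pairing_commute)
    also have "\<dots> = poly (durrmeyer_poly n (?E j)) x"
      by (simp add: kernel_slice_def durrmeyer_poly_def pairing_poly_linear poly_sum mult.commute)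
    finally show ?thesis
      by (simp add: durrmeyer_poly_monic_legendre)
  qed
  then show ?thesis
    using legendre_expansion[of "Suc N" "kernel_slice n x", OF coeffs]
    by (simp only: lessThan_Suc_atMost)
qed

text \<open>
  After the first operator the iterates are polynomials, expanded in the \<open>E\<^sub>j\<close>, and each further
  operator multiplies the coefficients by its eigenvalues. The empty composition is the
  identity, which has no such expansion; hence the count starts at \<open>Suc r\<close>.
\<close>
lemma bernstein_durrmeyer_comp_spectral:
  assumes f: "set_integrable lebesgue {0..1} f"
    and bound: "\<And>i. i \<in> {1..Suc r} \<Longrightarrow> m i \<le> N"
  shows "bernstein_durrmeyer_comp m (Suc r) f x = (\<Sum>j\<le>N.
    (\<Prod>i=1..Suc r. eigenvalue (m i) j) * pairing f (monic_legendre j) / legendre_norm_sq j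
      * poly (monic_legendre j) x)"
  using bound
proof (induction r arbitrary: x)
  case 0
  then have "m (Suc 0) \<le> N"
    by simp
  then show ?case
    by (simp add: bernstein_durrmeyer_eq_pairing[OF f] kernel_slice_spectral pairing_sum[OF f] mult_ac)
next
  case (Suc r)
  let ?E = monic_legendre
  define a where "a j = (\<Prod>i=1..Suc r. eigenvalue (m i) j) * pairing f (?E j) / legendre_norm_sq j" for j
  define p where "p = (\<Sum>j\<le>N. smult (a j) (?E j))"
  have le: "m (Suc (Suc r)) \<le> N"
    using Suc.prems by simp
  have "bernstein_durrmeyer_comp m (Suc r) f = poly p"
    using Suc.IH Suc.prems by (auto simp: fun_eq_iff p_def a_def poly_sum)
  then have "bernstein_durrmeyer_comp m (Suc (Suc r)) f x = bernstein_durrmeyer (m (Suc (Suc r))) (poly p) x"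
    by simp
  also have "\<dots> = pairing (poly p) (kernel_slice (m (Suc (Suc r))) x)"
    by (rule bernstein_durrmeyer_eq_pairing[OF set_integrable_poly])
  also have "\<dots> = (\<Sum>j\<le>N. eigenvalue (m (Suc (Suc r))) j * poly (?E j) x / legendre_norm_sq j * pairing (poly p) (?E j))"
    by (simp add: kernel_slice_spectral[OF le] pairing_poly_linear)
  also have "\<dots> = (\<Sum>j\<le>N. eigenvalue (m (Suc (Suc r))) j * a j * poly (?E j) x)"
  proof (intro sum.cong refl)
    fix j assume "j \<in> {..N}"
    have "pairing (poly p) (?E j) = (\<Sum>i\<le>N. a i * pairing (poly (?E j)) (?E i))"
      by (subst pairing_commute) (simp add: p_def pairing_poly_linear)
    also have "\<dots> = (\<Sum>i\<le>N. if i = j then a j * legendre_norm_sq j else 0)"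
      by (intro sum.cong refl) (auto simp: monic_legendre_orthogonal)
    finally have "pairing (poly p) (?E j) = a j * legendre_norm_sq j"
      using \<open>j \<in> {..N}\<close> by simp
    then show "eigenvalue (m (Suc (Suc r))) j * poly (?E j) x / legendre_norm_sq j * pairing (poly p) (?E j)
        = eigenvalue (m (Suc (Suc r))) j * a j * poly (?E j) x"
      by (simp add: legendre_norm_sq_neq_0)
  qed
  finally show ?case
    by (simp add: a_def mult_ac)
qed

section \<open>The linear system\<close>

text \<open>
  Back substitution: the last equation involves only the last unknown, and moving its
  contribution to the right-hand side leaves a smaller triangular system. Extensionality pins
  down the values outside the index range, which the equations do not see.
\<close>
lemma triangular_system_unique_solution:
  fixes A :: "nat \<Rightarrow> nat \<Rightarrow> 'a :: field"
  assumes lower: "\<And>j k. k < j \<Longrightarrow> A j k = 0" and diag: "\<And>j. A j j \<noteq> 0"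
  shows "\<exists>!c. c \<in> extensional {0..n} \<and> (\<forall>j\<in>{0..n}. (\<Sum>k=0..n. A j k * c k) = b j)"
proof -
  have ex: "\<exists>c. \<forall>j\<in>{0..n}. (\<Sum>k=0..n. A j k * c k) = b j" for b
  proof (induction n arbitrary: b)
    case 0
    show ?case
      by (rule exI[of _ "\<lambda>_. b 0 / A 0 0"]) (simp add: diag)
  next
    case (Suc n)
    define z where "z = b (Suc n) / A (Suc n) (Suc n)"
    obtain c where c: "\<forall>j\<in>{0..n}. (\<Sum>k=0..n. A j k * c k) = b j - A j (Suc n) * z"
      using Suc.IH[of "\<lambda>j. b j - A j (Suc n) * z"] by blast
    have upd: "(\<Sum>k=0..n. A j k * (c(Suc n := z)) k) = (\<Sum>k=0..n. A j k * c k)" for j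
      by (intro sum.cong) auto
    have "(\<Sum>k=0..Suc n. A j k * (c(Suc n := z)) k) = b j" if "j \<in> {0..Suc n}" for j
    proof (cases "j = Suc n")
      case True
      then have "(\<Sum>k=0..n. A j k * c k) = 0"
        by (intro sum.neutral) (auto simp: lower)
      with True show ?thesis
        by (simp add: upd z_def diag del: fun_upd_apply) (simp add: diag)
    next
      case False
      then show ?thesis
        using that c by (simp add: upd del: fun_upd_apply) simp
    qed
    then show ?case
      by blast
  qed
  have zero: "\<forall>j\<in>{0..n}. d j = 0" if "\<forall>j\<in>{0..n}. (\<Sum>k=0..n. A j k * d k) = 0" for d
    using that
  proof (induction n)
    case 0
    then show ?case
      by (simp add: diag)
  next
    case (Suc n)
    have "(\<Sum>k=0..n. A (Suc n) k * d k) = 0"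
      by (intro sum.neutral) (auto simp: lower)
    then have "d (Suc n) = 0"
      using Suc.prems diag by (auto dest!: bspec[of _ _ "Suc n"])
    moreover from this have "\<forall>j\<in>{0..n}. (\<Sum>k=0..n. A j k * d k) = 0"
      using Suc.prems by auto
    ultimately show ?case
      using Suc.IH by (auto simp: le_Suc_eq)
  qed
  show ?thesis
  proof (rule ex_ex1I)
    obtain c where c: "\<forall>j\<in>{0..n}. (\<Sum>k=0..n. A j k * c k) = b j"
      using ex by blast
    have "(\<Sum>k=0..n. A j k * restrict c {0..n} k) = (\<Sum>k=0..n. A j k * c k)" for j
      by (intro sum.cong) auto
    with c have "\<forall>j\<in>{0..n}. (\<Sum>k=0..n. A j k * restrict c {0..n} k) = b j"
      by simp
    then show "\<exists>c. c \<in> extensional {0..n} \<and> (\<forall>j\<in>{0..n}. (\<Sum>k=0..n. A j k * c k) = b j)"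
      using restrict_extensional by blast
  next
    fix c d
    assume c: "c \<in> extensional {0..n} \<and> (\<forall>j\<in>{0..n}. (\<Sum>k=0..n. A j k * c k) = b j)"
      and d: "d \<in> extensional {0..n} \<and> (\<forall>j\<in>{0..n}. (\<Sum>k=0..n. A j k * d k) = b j)"
    have "\<forall>j\<in>{0..n}. c j - d j = 0"
      by (rule zero) (use c d in \<open>simp add: right_diff_distrib sum_subtractf\<close>)
    then show "c = d"
      using c d by (intro extensionalityI[of c "{0..n}" d]) auto
  qed
qed

lemma kernel_system_eigenvalue:
  "kernel_system m r n c \<longleftrightarrow>
     (\<forall>j\<in>{0..n}. (\<Sum>k=0..n. eigenvalue k j * c k) = (\<Prod>i=1..r. eigenvalue (m i) j))"
  by (simp add: kernel_system_def eigenvalue_def)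

theorem theorem4:
  fixes r n :: nat and m :: "nat \<Rightarrow> nat"
  assumes "r \<ge> 1"
    and "\<And>i. i \<in> {1..r} \<Longrightarrow> m i \<ge> 1"
    and "n = Min (m ` {1..r})"
  shows "(\<exists>!c. c \<in> extensional {0..n} \<and> kernel_system m r n c) \<and>
    (\<forall>c. kernel_system m r n c \<longrightarrow>
      (\<forall>f. set_integrable lebesgue {0..1} f \<longrightarrow>
        (\<forall>x\<in>{0..1}. bernstein_durrmeyer_comp m r f x
           = (LINT y:{0..1}|lebesgue. f y * durrmeyer_kernel n c x y))))"
proof (intro conjI allI impI ballI)
  show "\<exists>!c. c \<in> extensional {0..n} \<and> kernel_system m r n c"
    unfolding kernel_system_eigenvalue
    by (rule triangular_system_unique_solution) (auto simp: eigenvalue_eq_0 eigenvalue_diagonal_neq_0)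
next
  fix c and f :: "real \<Rightarrow> real" and x :: real
  assume c: "kernel_system m r n c" and f: "set_integrable lebesgue {0..1} f"
  let ?E = monic_legendre
  define N where "N = Max (m ` {1..r})"
  have le_N: "m i \<le> N" if "i \<in> {1..r}" for i
    using that by (simp add: N_def)
  have "n \<in> m ` {1..r}"
    unfolding assms(3) using assms(1) by (intro Min_in) auto
  then obtain i0 where i0: "i0 \<in> {1..r}" "m i0 = n"
    by auto
  then have "n \<le> N"
    using le_N by auto
  \<comment> \<open>Beyond \<open>n\<close> the factor belonging to a minimal order kills the product.\<close>
  have system: "(\<Sum>k=0..n. eigenvalue k j * c k) = (\<Prod>i=1..r. eigenvalue (m i) j)" for j
  proof (cases "j \<le> n")
    case True
    then show ?thesis
      using c by (simp add: kernel_system_eigenvalue)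
  next
    case False
    then have "eigenvalue (m i0) j = 0"
      using i0 by (simp add: eigenvalue_eq_0)
    then have "(\<Prod>i=1..r. eigenvalue (m i) j) = 0"
      using i0 by (intro prod_zero) auto
    moreover have "(\<Sum>k=0..n. eigenvalue k j * c k) = 0"
      using False by (intro sum.neutral) (auto simp: eigenvalue_eq_0)
    ultimately show ?thesis
      by simp
  qed
  \<comment> \<open>The claimed kernel at \<open>x\<close>, whose expansion in the orthogonal basis has the left-hand sides of
    the system as coefficients.\<close>
  define K where "K = (\<Sum>k=0..n. smult (c k) (kernel_slice k x))"
  have "(LINT y:{0..1}|lebesgue. f y * durrmeyer_kernel n c x y) = pairing f K"
    by (simp add: pairing_def K_def durrmeyer_kernel_def poly_sum poly_kernel_slice mult_ac)
  also have "K = (\<Sum>k=0..n. \<Sum>j\<le>N. smult (eigenvalue k j * c k) (smult (poly (?E j) x / legendre_norm_sq j) (?E j)))"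
    unfolding K_def using \<open>n \<le> N\<close>
    by (intro sum.cong refl) (simp add: kernel_slice_spectral[of _ N] smult_sum_right mult_ac)
  also have "\<dots> = (\<Sum>j\<le>N. smult (\<Sum>k=0..n. eigenvalue k j * c k) (smult (poly (?E j) x / legendre_norm_sq j) (?E j)))"
    by (subst sum.swap) (simp only: smult_sum)
  also have "pairing f \<dots> = (\<Sum>j\<le>N.
    (\<Prod>i=1..r. eigenvalue (m i) j) * pairing f (?E j) / legendre_norm_sq j * poly (?E j) x)"
    unfolding system by (simp add: pairing_sum[OF f] mult_ac)
  also have "\<dots> = bernstein_durrmeyer_comp m r f x"
    using bernstein_durrmeyer_comp_spectral[OF f, of "r - 1" m N x] le_N assms(1) by simp
  finally show "bernstein_durrmeyer_comp m r f x = (LINT y:{0..1}|lebesgue. f y * durrmeyer_kernel n c x y)"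
    by simp
qed

end
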